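(* Let $b,c$ be integers, $f(x)=x^2-bx-c$, $\Delta=b^2+4c$, and let $n>1$ be an integer with $\gcd(n,2f(0)\Delta)=1$. If $\left(\frac{\Delta}{n}\right)=1$ and $x^n\equiv x\pmod{(n,f(x))}$, then $n$ is a Frobenius probable prime with respect to $f(x)$. If $\left(\frac{\Delta}{n}\right)=-1$ and $x^n\equiv b-x\pmod{(n,f(x))}$, then $n$ is a Frobenius probable prime with respect to $f(x)$.
   Context: Congruence mod $(n,f(x))$ means equality in $\mathbb{Z}[x]/(n,f(x))$; $\left(\frac{\cdot}{n}\right)$ is the Jacobi symbol. For monic polynomials $g_1,g_2$ over a commutative ring $R$ with identity, a monic $h\in R[x]$ is $\operatorname{gcmd}(g_1,g_2)$ if the ideal generated by $g_1,g_2$ equals the ideal generated by $h$ (it may fail to exist). Let $f(x)\in\mathbb{Z}[x]$ be monic of degree $d$ with discriminant $\Delta$. An odd integer $n>1$ is a Frobenius probable prime with respect to $f$ if $\gcd(n,f(0)\Delta)=1$ and, with all computations in $(\mathbb{Z}/n\mathbb{Z})[x]$: (Factorization) setting $f_0=f\bmod n$ and, for $1\le i\le d$, $F_i=\operatorname{gcmd}(x^{n^i}-x,f_{i-1})$ and $f_i=f_{i-1}/F_i$, all these gcmds exist and $f_d=1$; (Frobenius) for $2\le i\le d$, $F_i(x^n)\equiv 0\pmod{F_i(x)}$; (Jacobi) with $S=\sum_{2\mid i}\deg(F_i)/i$, $(-1)^S=\left(\frac{\Delta}{n}\right)$. *)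

theory Defs
  imports
    "HOL-Algebra.UnivPoly"
    "HOL-Number_Theory.Number_Theory"
    "Subresultants.Resultant_Prelim"
begin

definition Jacobi :: "int \<Rightarrow> nat \<Rightarrow> int" where
  "Jacobi a n = (\<Prod>p\<in>#prime_factorization n. Legendre a (int p))"

definition discriminant :: "int poly \<Rightarrow> int" where
  "discriminant f =
     (- 1) ^ (degree f * (degree f - 1) div 2) * resultant f (pderiv f) div lead_coeff f"

(* Equality of the classes of p and q in Z[x] / (n, f): p - q lies in the ideal
   generated by the constant n and f. *)
definition poly_cong :: "int poly \<Rightarrow> int poly \<Rightarrow> nat \<Rightarrow> int poly \<Rightarrow> bool" where
  "poly_cong p q n f \<longleftrightarrow> (\<exists>u v. p - q = [:int n:] * u + f * v)"

definition monic_UP :: "('a, 'm) ring_scheme \<Rightarrow> (nat \<Rightarrow> 'a) \<Rightarrow> bool" where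
  "monic_UP R g \<longleftrightarrow> g \<in> carrier (UP R) \<and> up_ring.coeff (UP R) g (deg R g) = \<one>\<^bsub>R\<^esub>"

(* h is the greatest common monic divisor of g1 and g2. A gcmd need not exist; if it does,
   it is unique, since monic generators of the same ideal coincide. *)
definition is_gcmd ::
  "('a, 'm) ring_scheme \<Rightarrow> (nat \<Rightarrow> 'a) \<Rightarrow> (nat \<Rightarrow> 'a) \<Rightarrow> (nat \<Rightarrow> 'a) \<Rightarrow> bool" where
  "is_gcmd R g1 g2 h \<longleftrightarrow>
     monic_UP R g1 \<and> monic_UP R g2 \<and> monic_UP R h \<and>
     Idl\<^bsub>UP R\<^esub> {g1, g2} = Idl\<^bsub>UP R\<^esub> {h}"

definition X_pow :: "('a, 'm) ring_scheme \<Rightarrow> nat \<Rightarrow> nat \<Rightarrow> 'a" where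
  "X_pow R k = up_ring.monom (UP R) \<one>\<^bsub>R\<^esub> k"

(* g(x^k), obtained by evaluating g in the R-algebra R[x] at x^k *)
definition subst_X_pow :: "('a, 'm) ring_scheme \<Rightarrow> nat \<Rightarrow> (nat \<Rightarrow> 'a) \<Rightarrow> nat \<Rightarrow> 'a" where
  "subst_X_pow R k g = eval R (UP R) (\<lambda>a. up_ring.monom (UP R) a 0) (X_pow R k) g"

(* the image of an integer polynomial in (Z/nZ)[x] = UP (residue_ring n) *)
definition reduce_mod :: "nat \<Rightarrow> int poly \<Rightarrow> nat \<Rightarrow> int" where
  "reduce_mod n f = (\<lambda>i. poly.coeff f i mod int n)"

(* Here g i is the polynomial f_i. The F i are determined by uniqueness of the gcmd, and
   the g i by cancellation of the monic F i, so the existential quantifier merely names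
   the output of the factorization step. The sum defining S is taken in the rationals,
   and S is required to be an integer so that (-1)^S is meaningful. *)
definition frobenius_probable_prime :: "nat \<Rightarrow> int poly \<Rightarrow> bool" where
  "frobenius_probable_prime n f \<longleftrightarrow>
     lead_coeff f = 1 \<and> odd n \<and> n > 1 \<and>
     gcd (int n) (poly f 0 * discriminant f) = 1 \<and>
     (let R = residue_ring (int n); P = UP R; d = degree f in
       \<exists>F g.
         g 0 = reduce_mod n f \<and>
         (\<forall>i\<in>{1..d}.
            is_gcmd R (X_pow R (n ^ i) \<ominus>\<^bsub>P\<^esub> X_pow R 1) (g (i - 1)) (F i) \<and>
            g i \<in> carrier P \<and> g (i - 1) = F i \<otimes>\<^bsub>P\<^esub> g i) \<and>
         g d = \<one>\<^bsub>P\<^esub> \<and>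
         (\<forall>i\<in>{2..d}. subst_X_pow R n (F i) \<in> PIdl\<^bsub>P\<^esub> (F i)) \<and>
         (\<exists>S::nat.
            of_nat S = (\<Sum>i | i \<in> {1..d} \<and> even i. of_nat (deg R (F i)) / of_nat i :: rat) \<and>
            (- 1) ^ S = Jacobi (discriminant f) n))"

end

theory Submission
  imports Defs
begin

text \<open>
  If \<open>x ^ n \<equiv> x\<close>, then \<open>f\<close> divides \<open>x ^ n - x\<close>, so \<open>F 1 = f\<close> and \<open>F 2 = 1\<close>.

  If \<open>x ^ n \<equiv> b - x\<close>, then modulo \<open>f\<close> the polynomial \<open>x ^ n - x\<close> is \<open>b - 2 x\<close>, whose square
  \<open>4 f + \<Delta>\<close> is a unit, so \<open>F 1 = 1\<close>. Since \<open>x \<mapsto> b - x\<close> fixes \<open>f\<close>, it acts on the quotient by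
  \<open>f\<close>; applying it to the hypothesis gives \<open>(b - x) ^ n \<equiv> x\<close>, so \<open>x ^ (n\<^sup>2) \<equiv> x\<close> and \<open>F 2 = f\<close>.
  Likewise \<open>f(x ^ n) \<equiv> f(b - x) = f(x)\<close>, which is the Frobenius step.
\<close>

section \<open>Congruence modulo an integer and a polynomial\<close>

lemma poly_cong_refl: "poly_cong p p n f"
  unfolding poly_cong_def by (rule exI[of _ 0], rule exI[of _ 0]) simp

lemma poly_cong_sym: assumes "poly_cong p q n f" shows "poly_cong q p n f"
proof -
  obtain u v where "p - q = [:int n:] * u + f * v"
    using assms unfolding poly_cong_def by blast
  hence "q - p = [:int n:] * (- u) + f * (- v)"
    by (simp add: algebra_simps)
  thus ?thesis unfolding poly_cong_def by blast
qed

lemma poly_cong_add: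
  assumes "poly_cong p q n f" and "poly_cong r s n f"
  shows "poly_cong (p + r) (q + s) n f"
proof -
  obtain u v u' v' where
    "p - q = [:int n:] * u + f * v" "r - s = [:int n:] * u' + f * v'"
    using assms unfolding poly_cong_def by blast
  hence "(p + r) - (q + s) = [:int n:] * (u + u') + f * (v + v')"
    by (simp only: add_diff_add distrib_left add_ac)
  thus ?thesis unfolding poly_cong_def by blast
qed

lemma poly_cong_trans:
  assumes "poly_cong p q n f" and "poly_cong q r n f"
  shows "poly_cong p r n f"
proof -
  obtain u v u' v' where
    "p - q = [:int n:] * u + f * v" "q - r = [:int n:] * u' + f * v'"
    using assms unfolding poly_cong_def by blast
  hence "(p - q) + (q - r) = [:int n:] * (u + u') + f * (v + v')"
    by (simp only: distrib_left add_ac)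
  hence "p - r = [:int n:] * (u + u') + f * (v + v')"
    by simp
  thus ?thesis unfolding poly_cong_def by blast
qed

lemma poly_cong_mult_left:
  assumes "poly_cong p q n f" shows "poly_cong (r * p) (r * q) n f"
proof -
  obtain u v where "p - q = [:int n:] * u + f * v"
    using assms unfolding poly_cong_def by blast
  hence "r * (p - q) = [:int n:] * (r * u) + f * (r * v)"
    by (simp only: distrib_left) (simp only: ac_simps)
  hence "r * p - r * q = [:int n:] * (r * u) + f * (r * v)"
    by (simp only: right_diff_distrib)
  thus ?thesis unfolding poly_cong_def by blast
qed

lemma poly_cong_mult:
  assumes "poly_cong p q n f" and "poly_cong r s n f"
  shows "poly_cong (p * r) (q * s) n f"
proof (rule poly_cong_trans)
  show "poly_cong (p * r) (p * s) n f"
    using assms(2) by (rule poly_cong_mult_left)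
  show "poly_cong (p * s) (q * s) n f"
    using poly_cong_mult_left[OF assms(1), of s] by (simp only: mult.commute)
qed

lemma poly_cong_diff:
  assumes "poly_cong p q n f" and "poly_cong r s n f"
  shows "poly_cong (p - r) (q - s) n f"
  using poly_cong_add[OF assms(1) poly_cong_mult_left[OF assms(2), of "- 1"]] by simp

lemma poly_cong_power:
  assumes "poly_cong p q n f" shows "poly_cong (p ^ k) (q ^ k) n f"
  by (induction k) (simp_all add: poly_cong_refl poly_cong_mult assms)

lemma poly_cong_pcompose_right:
  assumes "poly_cong p q n f" shows "poly_cong (pcompose g p) (pcompose g q) n f"
  by (induction g)
    (auto simp: pcompose_pCons intro!: poly_cong_add poly_cong_mult poly_cong_refl assms)

text \<open>Substituting \<open>r\<close> fixes both the constant \<open>n\<close> and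
  \<open>f\<close>, so it maps the ideal they generate into itself and acts on the quotient. It is
  applied to the conjugation sending x to b - x.\<close>

lemma poly_cong_pcompose_left:
  assumes "poly_cong p q n f" and "pcompose f r = f"
  shows "poly_cong (pcompose p r) (pcompose q r) n f"
proof -
  obtain u v where "p - q = [:int n:] * u + f * v"
    using assms unfolding poly_cong_def by blast
  hence "pcompose (p - q) r = pcompose ([:int n:] * u + f * v) r"
    by simp
  hence "pcompose p r - pcompose q r = [:int n:] * pcompose u r + f * pcompose v r"
    by (simp only: pcompose_diff pcompose_add pcompose_mult pcompose_const assms(2))
  thus ?thesis unfolding poly_cong_def by blast
qed

section \<open>Reduction to the polynomial ring over the residue ring\<close>

lemma (in cring) Idl_pair_eq_Idl_right:
  assumes "a \<in> carrier R" "b \<in> carrier R" "q \<in> carrier R" "a = b \<otimes> q"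
  shows "Idl {a, b} = Idl {b}"
proof
  have "a \<in> PIdl b" unfolding cgenideal_def using assms m_comm by auto
  hence "a \<in> Idl {b}" using cgenideal_eq_genideal assms by simp
  thus "Idl {a, b} \<subseteq> Idl {b}"
    using assms by (intro genideal_minimal genideal_ideal) (auto simp: genideal_self')
  show "Idl {b} \<subseteq> Idl {a, b}"
    using assms genideal_self[of "{a, b}"] by (intro genideal_minimal genideal_ideal) auto
qed

text \<open>A Bezout relation puts \<open>\<one>\<close> into the ideal, which is then the whole
  ring.\<close>

lemma (in cring) Idl_pair_eq_Idl_one:
  assumes "a \<in> carrier R" "b \<in> carrier R" "r \<in> carrier R" "s \<in> carrier R"
    and "r \<otimes> a \<oplus> s \<otimes> b = \<one>"
  shows "Idl {a, b} = Idl {\<one>}"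
proof -
  interpret I: ideal "Idl {a, b}" R
    using assms by (intro genideal_ideal) auto
  have "a \<in> Idl {a, b}" "b \<in> Idl {a, b}"
    using assms genideal_self[of "{a, b}"] by auto
  hence "r \<otimes> a \<oplus> s \<otimes> b \<in> Idl {a, b}"
    using assms by (intro I.a_closed I.I_l_closed)
  thus ?thesis
    using assms(5) I.one_imp_carrier genideal_one by simp
qed

text \<open>Here \<open>reduce_mod n\<close> is shown to be a ring homomorphism from Z[x] to
  (Z/nZ)[x]. Calculations can then be done with integer polynomials and transferred to
  \<open>P\<close> only at the end.\<close>

locale residue_polys = residues "int n" R + UP_cring R P
  for n :: nat and R (structure) and P (structure)
begin

abbreviation red :: "int poly \<Rightarrow> nat \<Rightarrow> int" where
  "red \<equiv> reduce_mod n"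

lemma red_up: "red p \<in> up R"
proof (rule mem_upI)
  show "red p k \<in> carrier R" for k
    by (simp add: reduce_mod_def)
  have "bound \<zero> (degree p) (red p)"
    by (auto simp: reduce_mod_def res_zero_eq coeff_eq_0)
  thus "\<exists>k. bound \<zero> k (red p)" ..
qed

lemma red_closed [simp, intro]: "red p \<in> carrier P"
  using red_up by (simp add: P_def UP_def)

lemma coeff_red [simp]: "up_ring.coeff P (red p) k = poly.coeff p k mod int n"
  using red_up by (simp add: P_def UP_def) (simp add: reduce_mod_def)

lemma red_zero: "red 0 = \<zero>\<^bsub>P\<^esub>"
  by (rule up_eqI) (auto simp: res_zero_eq)

lemma red_one: "red 1 = \<one>\<^bsub>P\<^esub>"
  using m_gt_one by (intro up_eqI) (auto simp: res_zero_eq res_one_eq)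

lemma red_add: "red (p + q) = red p \<oplus>\<^bsub>P\<^esub> red q"
  by (rule up_eqI) (auto simp: add_cong)

lemma red_mult: "red (p * q) = red p \<otimes>\<^bsub>P\<^esub> red q"
proof (rule up_eqI)
  fix k
  have "up_ring.coeff P (red p \<otimes>\<^bsub>P\<^esub> red q) k =
      (\<Oplus>i\<in>{..k}. (poly.coeff p i * poly.coeff q (k - i)) mod int n)"
    by (simp add: mult_cong)
  also have "\<dots> = (\<Sum>i\<le>k. poly.coeff p i * poly.coeff q (k - i)) mod int n"
    by (rule sum_cong) simp
  finally show "up_ring.coeff P (red (p * q)) k = up_ring.coeff P (red p \<otimes>\<^bsub>P\<^esub> red q) k"
    by (simp add: Polynomial.coeff_mult)
qed auto

lemma red_monom: "red (Polynomial.monom a k) = up_ring.monom P (a mod int n) k"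
  by (rule up_eqI) (auto simp: res_zero_eq)

lemma red_X_pow: "red (Polynomial.monom 1 k) = X_pow R k"
  using red_monom[of 1 k] m_gt_one by (simp add: X_pow_def P_def res_one_eq)

lemma red_const: "red [:a:] = up_ring.monom P (a mod int n) 0"
  using red_monom[of a 0] by (simp add: monom_0)

lemma red_diff: "red (p - q) = red p \<ominus>\<^bsub>P\<^esub> red q"
proof -
  have "red (p - q) \<oplus>\<^bsub>P\<^esub> red q = red p"
    by (simp flip: red_add)
  thus ?thesis
    by (metis P.add.inv_solve_right a_minus_def red_closed)
qed

lemma red_modulus: "red [:int n:] = \<zero>\<^bsub>P\<^esub>"
  using monom_zero[of 0] by (simp add: red_const res_zero_eq)

text \<open>Reduction kills the multiple of \<open>n\<close>, so only the multiple of
  \<open>f\<close> survives: a congruence becomes a divisibility over Z/nZ.\<close>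

lemma red_eq_of_poly_cong:
  assumes "poly_cong p q n f"
  obtains v where "red p = red q \<oplus>\<^bsub>P\<^esub> red f \<otimes>\<^bsub>P\<^esub> red v"
proof -
  obtain u v where "p - q = [:int n:] * u + f * v"
    using assms unfolding poly_cong_def by blast
  hence "p = q + ([:int n:] * u + f * v)"
    by (simp add: algebra_simps)
  hence "red p = red q \<oplus>\<^bsub>P\<^esub> (red [:int n:] \<otimes>\<^bsub>P\<^esub> red u \<oplus>\<^bsub>P\<^esub> red f \<otimes>\<^bsub>P\<^esub> red v)"
    by (simp only: red_add red_mult)
  thus ?thesis
    using that by (simp add: red_modulus)
qed

lemma red_in_PIdl:
  assumes "poly_cong p 0 n f" shows "red p \<in> PIdl\<^bsub>P\<^esub> (red f)"
proof -
  obtain v where "red p = red 0 \<oplus>\<^bsub>P\<^esub> red f \<otimes>\<^bsub>P\<^esub> red v"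
    using red_eq_of_poly_cong[OF assms] .
  hence "red p = red v \<otimes>\<^bsub>P\<^esub> red f"
    by (simp add: red_zero P.m_comm)
  thus ?thesis unfolding cgenideal_def by auto
qed

section \<open>Monic polynomials and gcmds after reduction\<close>

lemma deg_red:
  assumes "lead_coeff p = 1" shows "deg R (red p) = degree p"
proof (rule antisym)
  show "deg R (red p) \<le> degree p"
    by (rule deg_aboveI) (auto simp: coeff_eq_0 res_zero_eq)
  \<comment> \<open>The leading coefficient 1 stays nonzero because \<open>n\<close> exceeds
    1.\<close>
  show "degree p \<le> deg R (red p)"
    using assms m_gt_one by (intro deg_belowI) (auto simp: res_zero_eq)
qed

lemma monic_red:
  assumes "lead_coeff p = 1" shows "monic_UP R (red p)"
  using assms m_gt_one red_closed[of p] coeff_red[of p "degree p"]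
  by (simp add: monic_UP_def deg_red res_one_eq flip: P_def)

text \<open>The congruence makes \<open>red q\<close> divide \<open>red p\<close>, so
  \<open>red p\<close> adds nothing to the ideal of \<open>red q\<close>.\<close>

lemma is_gcmd_red_right:
  assumes "lead_coeff p = 1" "lead_coeff q = 1" "poly_cong p 0 n q"
  shows "is_gcmd R (red p) (red q) (red q)"
proof -
  obtain v where "red p = red 0 \<oplus>\<^bsub>P\<^esub> red q \<otimes>\<^bsub>P\<^esub> red v"
    using red_eq_of_poly_cong[OF assms(3)] .
  hence "Idl\<^bsub>P\<^esub> {red p, red q} = Idl\<^bsub>P\<^esub> {red q}"
    by (intro P.Idl_pair_eq_Idl_right[of _ _ "red v"]) (auto simp: red_zero)
  thus ?thesis
    using assms by (simp add: is_gcmd_def monic_red flip: P_def)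
qed

text \<open>The congruence says that \<open>r\<close> inverts \<open>p\<close> modulo
  \<open>n\<close> and \<open>q\<close>, which is a Bezout relation after reduction.\<close>

lemma is_gcmd_red_one:
  assumes "lead_coeff p = 1" "lead_coeff q = 1" "poly_cong 1 (r * p) n q"
  shows "is_gcmd R (red p) (red q) (red 1)"
proof -
  obtain v where "red 1 = red (r * p) \<oplus>\<^bsub>P\<^esub> red q \<otimes>\<^bsub>P\<^esub> red v"
    using red_eq_of_poly_cong[OF assms(3)] .
  hence "red r \<otimes>\<^bsub>P\<^esub> red p \<oplus>\<^bsub>P\<^esub> red v \<otimes>\<^bsub>P\<^esub> red q = \<one>\<^bsub>P\<^esub>"
    by (simp add: red_mult red_one P.m_comm)
  hence "Idl\<^bsub>P\<^esub> {red p, red q} = Idl\<^bsub>P\<^esub> {\<one>\<^bsub>P\<^esub>}"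
    by (intro P.Idl_pair_eq_Idl_one[of _ _ "red r" "red v"]) auto
  thus ?thesis
    using assms monic_red[of 1] by (simp add: is_gcmd_def monic_red red_one flip: P_def)
qed

text \<open>Evaluation at x^k is a ring homomorphism fixing constants, and composition obeys the
  same Horner recursion, so induction on the coefficients identifies the two.\<close>

lemma subst_X_pow_red: "subst_X_pow R k (red p) = red (pcompose p (Polynomial.monom 1 k))"
proof -
  let ?c = "\<lambda>a. up_ring.monom P a 0"
  interpret U: UP_pre_univ_prop R P ?c P
    by unfold_locales (rule const_ring_hom)
  interpret E: UP_univ_prop R P ?c P "X_pow R k" "eval R P ?c (X_pow R k)"
    by unfold_locales (simp_all flip: red_X_pow)
  have "eval R P ?c (X_pow R k) (red p) = red (pcompose p (Polynomial.monom 1 k))"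
  proof (induction p)
    case 0
    show ?case by (simp add: red_zero)
  next
    case (pCons a p)
    have "pCons a p = [:a:] + Polynomial.monom 1 1 * p"
      by (simp add: monom_altdef)
    hence "red (pCons a p) = ?c (a mod int n) \<oplus>\<^bsub>P\<^esub> up_ring.monom P \<one> 1 \<otimes>\<^bsub>P\<^esub> red p"
      using m_gt_one by (simp add: red_add red_mult red_const red_monom res_one_eq)
    moreover have "eval R P ?c (X_pow R k) (up_ring.monom P \<one> 1) = X_pow R k"
      by (rule U.eval_monom1) simp
    ultimately show ?case
      using pCons.IH
      by (simp add: pcompose_pCons red_add red_mult red_const red_X_pow U.eval_const)
  qed
  thus ?thesis by (simp add: subst_X_pow_def P_def)
qed

end

lemma residue_polysI:
  assumes "n > 1" shows "residue_polys n"
proof -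
  have "residues (int n)"
    using assms by unfold_locales simp
  thus ?thesis
    by (intro residue_polys.intro UP_cring.intro residues.cring)
qed

section \<open>Quadratic polynomials\<close>

lemma det_2:
  assumes A: "A \<in> carrier_mat 2 2"
  shows "det A = A $$ (0,0) * A $$ (1,1) - A $$ (0,1) * A $$ (1,0)"
proof -
  have "det A = (\<Sum>i<2. A $$ (i,0) * cofactor A i 0)"
    by (rule laplace_expansion_column[OF A]) simp
  thus ?thesis
    using A by (simp add: numeral_2_eq_2 cofactor_def det_single mat_delete_def)
qed

lemma det_3:
  assumes A: "A \<in> carrier_mat 3 3"
  shows "det A =
    A $$ (0,0) * (A $$ (1,1) * A $$ (2,2) - A $$ (1,2) * A $$ (2,1)) -
    A $$ (1,0) * (A $$ (0,1) * A $$ (2,2) - A $$ (0,2) * A $$ (2,1)) +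
    A $$ (2,0) * (A $$ (0,1) * A $$ (1,2) - A $$ (0,2) * A $$ (1,1))"
proof -
  \<comment> \<open>\<open>r\<close> and \<open>s\<close> are the two rows left, in increasing
    order, once row \<open>i\<close> is deleted.\<close>
  have minor: "det (mat_delete A i 0) =
      A $$ (r, 1) * A $$ (s, 2) - A $$ (r, 2) * A $$ (s, 1)"
    if "r = (if i = 0 then 1 else 0)" "s = (if i \<le> 1 then 2 else 1)" "i < 3" for i r s
    using that A det_2[of "mat_delete A i 0"] by (auto simp: mat_delete_def numeral_2_eq_2)
  have "det A = (\<Sum>i<3. A $$ (i,0) * cofactor A i 0)"
    by (rule laplace_expansion_column[OF A]) simp
  also have "{..<3} = {0, 1, 2::nat}" by auto
  finally show ?thesis
    using minor[of _ _ 0] minor[of _ _ 1] minor[of _ _ 2] by (simp add: cofactor_def algebra_simps)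
qed

lemma discriminant_quadratic: "discriminant [:- c, - b, 1:] = b\<^sup>2 + 4 * c"
proof -
  \<comment> \<open>This is the Sylvester matrix of the quadratic and its derivative 2x - b. Its
    determinant is minus the expected value; the sign factor of \<open>discriminant\<close> in
    degree 2 corrects this.\<close>
  let ?A = "sylvester_mat_sub 2 1 [:- c, - b, 1:] [:- b, 2:]"
  have "?A \<in> carrier_mat 3 3"
    using sylvester_mat_sub_carrier[of 2 1] by simp
  hence "resultant [:- c, - b, 1:] [:- b, 2:] = - (b\<^sup>2 + 4 * c)"
    unfolding resultant_def sylvester_mat_def
    by (simp add: det_3 sylvester_mat_sub_def numeral_2_eq_2)
  thus ?thesis
    by (simp add: discriminant_def pderiv_pCons)
qed

section \<open>The Frobenius test in degree two\<close>

lemma lead_coeff_monom_diff_X: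
  assumes "m > 1"
  shows "lead_coeff (Polynomial.monom 1 m - Polynomial.monom 1 1 :: int poly) = 1"
proof -
  have "degree (Polynomial.monom 1 m - Polynomial.monom 1 1 :: int poly) = m"
    using assms degree_add_eq_left[of "- Polynomial.monom 1 1" "Polynomial.monom (1::int) m"]
    by (simp add: degree_monom_eq)
  thus ?thesis using assms by simp
qed

text \<open>In degree 2 the factorization step amounts to \<open>f = F1 * F2\<close>: dividing out
  the first gcmd leaves \<open>F2\<close>, and \<open>F2\<close> divides x^(n^2) - x modulo
  \<open>n\<close>, so it is the second gcmd and the quotient is 1. The theorem uses this with one
  factor \<open>f\<close> and the other 1.\<close>

lemma frobenius_probable_prime_quadraticI:
  fixes F1 F2 :: "int poly"
  assumes n: "n > 1" "odd n" and f: "lead_coeff f = 1" "degree f = 2"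
    and gcd: "gcd (int n) (poly f 0 * discriminant f) = 1"
    and F1: "is_gcmd (residue_ring (int n)) (reduce_mod n (Polynomial.monom 1 n - Polynomial.monom 1 1))
               (reduce_mod n f) (reduce_mod n F1)"
    and F: "f = F1 * F2" "lead_coeff F2 = 1"
    and F2: "poly_cong (Polynomial.monom 1 (n\<^sup>2) - Polynomial.monom 1 1) 0 n F2"
    and frob: "poly_cong (pcompose F2 (Polynomial.monom 1 n)) 0 n F2"
    and S: "degree F2 = 2 * S" and Jacobi: "(- 1) ^ S = Jacobi (discriminant f) n"
  shows "frobenius_probable_prime n f"
proof -
  let ?R = "residue_ring (int n)"
  let ?P = "UP ?R"
  interpret residue_polys n ?R ?P
    using n(1) by (rule residue_polysI)
  \<comment> \<open>Only \<open>F\<close> at 1, 2 and \<open>g\<close> at 0, 1, 2 are constrained;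
    the values elsewhere are fillers.\<close>
  define F where "F i = (if i = 1 then red F1 else red F2)" for i :: nat
  define g where "g i = (if i = 0 then red f else if i = 1 then red F2 else red 1)" for i :: nat
  have X: "X_pow ?R (n ^ i) \<ominus>\<^bsub>?P\<^esub> X_pow ?R 1
      = red (Polynomial.monom 1 (n ^ i) - Polynomial.monom 1 1)" for i
    by (simp only: red_diff red_X_pow)
  have "is_gcmd ?R (red (Polynomial.monom 1 (n\<^sup>2) - Polynomial.monom 1 1)) (red F2) (red F2)"
    using n(1) F(2) F2 one_less_power[of n 2] by (intro is_gcmd_red_right lead_coeff_monom_diff_X) auto
  hence step: "is_gcmd ?R (X_pow ?R (n ^ i) \<ominus>\<^bsub>?P\<^esub> X_pow ?R 1) (g (i - 1)) (F i) \<and>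
      g i \<in> carrier ?P \<and> g (i - 1) = F i \<otimes>\<^bsub>?P\<^esub> g i" if "i \<in> {1..2}" for i
  proof -
    from that consider "i = 1" | "i = 2" by fastforce
    thus ?thesis
      using F1 \<open>is_gcmd ?R _ (red F2) _\<close> F(1) unfolding X
      by cases (simp_all add: F_def g_def flip: red_mult)
  qed
  \<comment> \<open>The sum for \<open>S\<close> has the single term with index 2, namely half the
    degree of \<open>F2\<close>.\<close>
  have "{i. i \<in> {1..2} \<and> even i} = {2::nat}"
    by (auto simp: le_Suc_eq numeral_2_eq_2)
  hence sum: "of_nat S =
      (\<Sum>i | i \<in> {1..2} \<and> even i. of_nat (deg ?R (F i)) / of_nat i :: rat)"
    using S F(2) by (simp add: F_def deg_red)
  have "subst_X_pow ?R n (F i) \<in> PIdl\<^bsub>?P\<^esub> (F i)" if "i \<in> {2..2}" for i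
    using that red_in_PIdl[OF frob] by (simp add: F_def subst_X_pow_red)
  moreover have "g 0 = red f" "g 2 = \<one>\<^bsub>?P\<^esub>"
    by (simp_all add: g_def red_one)
  ultimately show ?thesis
    unfolding frobenius_probable_prime_def Let_def f(2)
    using n f(1)[unfolded f(2)] gcd step sum Jacobi by blast
qed

theorem theorem7p1:
  fixes b c \<Delta> :: int and n :: nat and f :: "int poly"
  assumes f: "f = monom 1 2 - monom b 1 - [:c:]"
    and \<Delta>: "\<Delta> = b ^ 2 + 4 * c"
    and n: "n > 1"
    and coprime_n: "gcd (int n) (2 * poly f 0 * \<Delta>) = 1"
  shows "(Jacobi \<Delta> n = 1 \<and> poly_cong (monom 1 n) (monom 1 1) n f
            \<longrightarrow> frobenius_probable_prime n f) \<and>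
         (Jacobi \<Delta> n = - 1 \<and> poly_cong (monom 1 n) ([:b:] - monom 1 1) n f
            \<longrightarrow> frobenius_probable_prime n f)"
proof -
  interpret residue_polys n "residue_ring (int n)" "UP (residue_ring (int n))"
    using n by (rule residue_polysI)
  let ?X = "Polynomial.monom (1 :: int)"
  have f': "f = [:- c, - b, 1:]"
    by (simp add: f monom_altdef numeral_2_eq_2 algebra_simps)
  have lead: "lead_coeff f = 1" and deg: "degree f = 2"
    by (simp_all add: f')
  have disc: "discriminant f = \<Delta>"
    by (simp add: f' \<Delta> discriminant_quadratic)
  \<comment> \<open>The factor 2 in the gcd yields that \<open>n\<close> is odd.\<close>
  have "coprime (int n) 2" "coprime (int n) (poly f 0)" and coprime_\<Delta>: "coprime (int n) \<Delta>"
    using coprime_n by (simp_all flip: coprime_iff_gcd_eq_1)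
  hence odd: "odd n" and gcd: "gcd (int n) (poly f 0 * discriminant f) = 1"
    by (simp_all add: disc flip: coprime_iff_gcd_eq_1)
  note frobI = frobenius_probable_prime_quadraticI[OF n odd lead deg gcd]
  have f_zero: "poly_cong f 0 n f"
    unfolding poly_cong_def by (rule exI[of _ 0], rule exI[of _ 1]) simp
  have cong_one: "poly_cong p 0 n 1" for p
    unfolding poly_cong_def by (rule exI[of _ 0], rule exI[of _ p]) simp
  show ?thesis
  proof (intro conjI impI; elim conjE)
    assume J: "Jacobi \<Delta> n = 1" and cong: "poly_cong (?X n) (?X 1) n f"
    have "poly_cong (?X n - ?X 1) 0 n f"
      using poly_cong_diff[OF cong poly_cong_refl[of "?X 1"]] by simp
    hence "is_gcmd (residue_ring (int n)) (red (?X n - ?X 1)) (red f) (red f)"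
      using n lead by (intro is_gcmd_red_right lead_coeff_monom_diff_X)
    thus "frobenius_probable_prime n f"
      \<comment> \<open>The second factor is 1, modulo which every polynomial vanishes, so its two
        congruences are trivial; the exponent is 0.\<close>
      using J by (intro frobI[of f 1 0] cong_one) (simp_all add: disc)
  next
    assume J: "Jacobi \<Delta> n = - 1" and cong: "poly_cong (?X n) ([:b:] - ?X 1) n f"
    let ?t = "[:b, - 2:]"
    have conj: "[:b:] - ?X 1 = [:b, - 1:]"
      by (simp add: monom_altdef)
    note cong = cong[unfolded conj]
    have "poly_cong (?X n - ?X 1) ?t n f"
      using poly_cong_diff[OF cong poly_cong_refl[of "?X 1"]] by (simp add: monom_altdef)
    \<comment> \<open>\<open>e\<close> is an inverse of \<Delta> modulo \<open>n\<close>.\<close>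
    obtain e k where "e * \<Delta> + k * int n = 1"
      using coprime_\<Delta> by (metis bezout_int coprime_iff_gcd_eq_1 gcd.commute)
    \<comment> \<open>Since \<open>?t * ?t\<close> equals 4f + \<Delta>, multiplying by
      \<open>e\<close> gives 1 up to multiples of \<open>n\<close> and \<open>f\<close>.\<close>
    hence "1 - [:e:] * ?t * ?t = [:int n:] * [:k:] + f * [:- 4 * e:]"
      by (simp add: f' \<Delta> algebra_simps power2_eq_square)
    hence "poly_cong 1 ([:e:] * ?t * ?t) n f"
      unfolding poly_cong_def by blast
    \<comment> \<open>Replacing one factor \<open>?t\<close> by x^n - x exhibits
      \<open>[:e:] * ?t\<close> as an inverse of x^n - x.\<close>
    moreover have "poly_cong ([:e:] * ?t * ?t) ([:e:] * ?t * (?X n - ?X 1)) n f"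
      by (rule poly_cong_mult_left[OF poly_cong_sym]) fact
    ultimately have "poly_cong 1 ([:e:] * ?t * (?X n - ?X 1)) n f"
      by (rule poly_cong_trans)
    hence F1: "is_gcmd (residue_ring (int n)) (red (?X n - ?X 1)) (red f) (red 1)"
      using n lead by (intro is_gcmd_red_one lead_coeff_monom_diff_X)
    \<comment> \<open>The map x to b - x exchanges the roots of \<open>f\<close>, whose sum is
      b.\<close>
    have conj_f: "pcompose f [:b, - 1:] = f"
      by (simp add: f' pcompose_pCons algebra_simps)
    \<comment> \<open>Conjugating the hypothesis turns x^n into (b - x)^n and b - x back into
      x.\<close>
    have "poly_cong (pcompose (?X n) [:b, - 1:]) (pcompose [:b, - 1:] [:b, - 1:]) n f"
      using cong conj_f by (rule poly_cong_pcompose_left)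
    hence "poly_cong ([:b, - 1:] ^ n) (?X 1) n f"
      by (simp add: monom_altdef pcompose_pCons pcompose_hom.hom_power)
    \<comment> \<open>Raising the hypothesis to the power \<open>n\<close> links x^(n^2) to (b -
      x)^n, hence to x.\<close>
    moreover have "poly_cong (?X n ^ n) ([:b, - 1:] ^ n) n f"
      using cong by (rule poly_cong_power)
    ultimately have "poly_cong (?X (n\<^sup>2)) (?X 1) n f"
      using poly_cong_trans by (simp add: monom_power power2_eq_square)
    hence F2: "poly_cong (?X (n\<^sup>2) - ?X 1) 0 n f"
      using poly_cong_diff[OF _ poly_cong_refl[of "?X 1"]] by fastforce
    have "poly_cong (pcompose f (?X n)) f n f"
      using poly_cong_pcompose_right[OF cong, of f] by (simp add: conj_f)
    hence "poly_cong (pcompose f (?X n)) 0 n f"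
      using f_zero by (rule poly_cong_trans)
    \<comment> \<open>The roles are now reversed: the first factor is 1, the second is
      \<open>f\<close>, and \<open>S\<close> is 1.\<close>
    thus "frobenius_probable_prime n f"
      using J lead deg F1 F2 by (intro frobI[of 1 f 1]) (simp_all add: disc)
  qed
qed

end
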